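(* For every $n\ge 1$, the transportation cost space $\mathrm{TC}(D_n)$ on the diamond graph $D_n$ does not contain a linear subspace isometric to $\ell_\infty^4$.
   Context: For a finite metric space $(X,d)$, $\mathrm{TC}(X)$ is the real vector space of functions $f:X\to\mathbb{R}$ with $\sum_{v\in X} f(v)=0$, with the norm $\|f\|_{\mathrm{TC}}=\inf \sum_{i=1}^n a_i d(x_i,y_i)$, the infimum over all representations $f=\sum_{i=1}^n a_i(\mathbf{1}_{x_i}-\mathbf{1}_{y_i})$ with $a_i\ge0$, $x_i,y_i\in X$, where $\mathbf 1_u$ is the indicator function of the point $u$. Diamond graphs are defined recursively: $D_0$ has two vertices joined by one edge. $D_n$ is obtained from $D_{n-1}$ by replacing each edge $uv\in E(D_{n-1})$ by a quadrilateral $u,a,v,b$ with edges $ua,av,vb,bu$, where $a,b$ are new vertices (distinct for different edges). Each edge of $D_n$ has weight $2^{-n}$, and $D_n$ is regarded as the metric space on its vertex set with the weighted graph distance. *)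

theory Defs
  imports
    "HOL-Analysis.Analysis"
    "HOL-Library.Function_Algebras"
    "Graph_Theory.Graph_Theory"
begin

section \<open>The vector space of real functions\<close>

text \<open>Addition of functions is the pointwise one of \<open>Function_Algebras\<close>.\<close>

definition fscale :: "real \<Rightarrow> ('a \<Rightarrow> real) \<Rightarrow> 'a \<Rightarrow> real" where
  "fscale c f = (\<lambda>x. c * f x)"

interpretation fun_space: vector_space fscale
  by unfold_locales (auto simp: fscale_def fun_eq_iff algebra_simps)


section \<open>Transportation cost spaces\<close>

text \<open>
  The points of a metric space are a set \<open>X\<close> in an ambient type.  A function
  \<open>X \<rightarrow> \<real>\<close> is represented by its extension by zero to the ambient type.
\<close>

definition TC :: "'a set \<Rightarrow> ('a \<Rightarrow> real) set" where
  "TC X = {f. (\<forall>v. v \<notin> X \<longrightarrow> f v = 0) \<and> (\<Sum>v\<in>X. f v) = 0}"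

definition TC_norm :: "'a set \<Rightarrow> ('a \<Rightarrow> 'a \<Rightarrow> real) \<Rightarrow> ('a \<Rightarrow> real) \<Rightarrow> real" where
  "TC_norm X d f =
     Inf {\<Sum>i<m. a i * d (x i) (y i) | (m :: nat) a x y.
            (\<forall>i<m. 0 \<le> a i \<and> x i \<in> X \<and> y i \<in> X) \<and>
            (\<forall>u. f u = (\<Sum>i<m. a i * (indicator {x i} u - indicator {y i} u)))}"

lemma subspace_TC: "fun_space.subspace (TC X)"
  by (auto simp: fun_space.subspace_def TC_def fscale_def sum.distrib simp flip: sum_distrib_left)


section \<open>Isometric copies of \<open>\<ell>\<^sub>\<infinity>\<close>\<close>

text \<open>
  \<open>W\<close>, normed by \<open>N\<close>, is linearly isometric to \<open>\<ell>\<^sub>\<infinity>\<^sup>k\<close> with \<open>k = CARD('k)\<close>: the norm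
  \<^const>\<open>infnorm\<close> on \<open>real ^ 'k\<close> is the supremum of the absolute values of the coordinates.
\<close>

definition isometric_to_linf ::
    "'k::finite itself \<Rightarrow> ('a \<Rightarrow> real) set \<Rightarrow> (('a \<Rightarrow> real) \<Rightarrow> real) \<Rightarrow> bool" where
  "isometric_to_linf k W N \<longleftrightarrow>
     (\<exists>T :: real ^ 'k \<Rightarrow> 'a \<Rightarrow> real.
        Vector_Spaces.linear (*\<^sub>R) fscale T \<and> bij_betw T UNIV W \<and> (\<forall>x. N (T x) = infnorm x))"


section \<open>Weighted graph distance\<close>

text \<open>
  The AFP distance \<open>\<mu>\<close> is extended-real valued; it is finite between the vertices of a
  connected graph.
\<close>

definition graph_dist :: "'a pair_pre_digraph \<Rightarrow> ('a \<times> 'a \<Rightarrow> real) \<Rightarrow> 'a \<Rightarrow> 'a \<Rightarrow> real" where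
  "graph_dist G w u v = real_of_ereal (wf_digraph.\<mu> (with_proj G) w u v)"


section \<open>Diamond graphs\<close>

text \<open>
  \<open>Mid u v False\<close> and \<open>Mid u v True\<close> are the two vertices \<open>a\<close>, \<open>b\<close> introduced when the edge
  \<open>uv\<close> is replaced by a quadrilateral.  So that every undirected edge is replaced only once, the
  recursion carries one (arbitrary) orientation of each edge, directed from \<open>Pole False\<close>
  towards \<open>Pole True\<close>; the diamond graph is the symmetric closure.
\<close>

datatype dvertex = Pole bool | Mid dvertex dvertex bool

definition diamond_step :: "dvertex pair_pre_digraph \<Rightarrow> dvertex pair_pre_digraph" where
  "diamond_step G =
     \<lparr> pverts = pverts G \<union> (\<Union>(u, v)\<in>parcs G. {Mid u v False, Mid u v True}),
       parcs = (\<Union>(u, v)\<in>parcs G.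
         {(u, Mid u v False), (Mid u v False, v), (u, Mid u v True), (Mid u v True, v)}) \<rparr>"

primrec oriented_diamond :: "nat \<Rightarrow> dvertex pair_pre_digraph" where
  "oriented_diamond 0 =
     \<lparr> pverts = {Pole False, Pole True}, parcs = {(Pole False, Pole True)} \<rparr>"
| "oriented_diamond (Suc n) = diamond_step (oriented_diamond n)"

definition diamond :: "nat \<Rightarrow> dvertex pair_pre_digraph" where
  "diamond n = mk_symmetric (with_proj (oriented_diamond n))"

definition diamond_dist :: "nat \<Rightarrow> dvertex \<Rightarrow> dvertex \<Rightarrow> real" where
  "diamond_dist n = graph_dist (diamond n) (\<lambda>_. 1 / 2 ^ n)"


subsection \<open>The vertices added in each step are new, and no edge is oriented both ways\<close>

primrec level :: "dvertex \<Rightarrow> nat" where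
  "level (Pole b) = 0"
| "level (Mid u v b) = Suc (max (level u) (level v))"

lemma oriented_diamond_wf:
  "(\<forall>e\<in>parcs (oriented_diamond n). fst e \<in> pverts (oriented_diamond n)
      \<and> snd e \<in> pverts (oriented_diamond n))"
  by (induction n) (fastforce simp: diamond_step_def)+

lemma oriented_diamond_finite:
  "finite (pverts (oriented_diamond n)) \<and> finite (parcs (oriented_diamond n))"
  by (induction n) (auto simp: diamond_step_def)

lemma oriented_diamond_level:
  "(\<forall>v\<in>pverts (oriented_diamond n). level v \<le> n) \<and>
   (\<forall>(u, v)\<in>parcs (oriented_diamond n). max (level u) (level v) = n \<and> u \<noteq> v)"
proof (induction n)
  case (Suc n)
  have "u \<noteq> Mid u v b" "v \<noteq> Mid u v b" for u v b
    by (metis level.simps(2) less_Suc_eq_le max.cobounded1 max.cobounded2 less_irrefl)+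
  with Suc oriented_diamond_wf[of n] show ?case
    by (fastforce simp: diamond_step_def)
qed auto

lemma Mid_fresh:
  "(u, v) \<in> parcs (oriented_diamond n) \<Longrightarrow> Mid u v b \<notin> pverts (oriented_diamond n)"
  using oriented_diamond_level[of n] by fastforce

lemma oriented_diamond_antisym:
  "(u, v) \<in> parcs (oriented_diamond n) \<Longrightarrow> (v, u) \<notin> parcs (oriented_diamond n)"
proof (induction n)
  case (Suc n)
  then show ?case
    using oriented_diamond_level[of n] oriented_diamond_wf[of n] Mid_fresh[of _ _ n]
    by (fastforce simp: diamond_step_def)
qed auto


subsection \<open>\<open>D\<^sub>n\<close> is a finite metric space\<close>

lemma parcs_diamond:
  "parcs (diamond n) = parcs (oriented_diamond n) \<union> (parcs (oriented_diamond n))\<inverse>"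
  by (force simp: diamond_def parcs_mk_symmetric)

lemma pverts_diamond [simp]: "pverts (diamond n) = pverts (oriented_diamond n)"
  by (simp add: diamond_def)

lemma pair_graph_diamond: "pair_graph (diamond n)"
proof
  show "symmetric (with_proj (diamond n))"
    unfolding diamond_def by (rule symmetric_mk_symmetric)
qed (use oriented_diamond_wf[of n] oriented_diamond_finite[of n] oriented_diamond_level[of n] in
      \<open>auto simp: parcs_diamond\<close>)

lemma diamond_reach_Pole:
  "v \<in> pverts (diamond n) \<Longrightarrow> (v, Pole False) \<in> (parcs (diamond n))\<^sup>*"
proof (induction n arbitrary: v)
  case 0
  then show ?case by (auto simp: parcs_diamond)
next
  case (Suc n)
  have 1: "(x, Mid x y False) \<in> parcs (diamond (Suc n))"
    "(Mid x y False, y) \<in> parcs (diamond (Suc n))"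
    "(y, Mid x y False) \<in> parcs (diamond (Suc n))"
    "(Mid x y b, x) \<in> parcs (diamond (Suc n))" if "(x, y) \<in> parcs (oriented_diamond n)" for x y b
    using that by (cases b; force simp: parcs_diamond diamond_step_def)+
  have "parcs (diamond n) \<subseteq> (parcs (diamond (Suc n)))\<^sup>*"
  proof
    fix e assume "e \<in> parcs (diamond n)"
    then obtain x y where "e = (x, y)" "(x, y) \<in> parcs (oriented_diamond n) \<or> (y, x) \<in> parcs (oriented_diamond n)"
      by (cases e) (auto simp: parcs_diamond)
    then show "e \<in> (parcs (diamond (Suc n)))\<^sup>*"
      using 1 by (meson converse_rtrancl_into_rtrancl r_into_rtrancl)
  qed
  then have 2: "(x, Pole False) \<in> (parcs (diamond (Suc n)))\<^sup>*" if "x \<in> pverts (diamond n)" for x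
    using Suc.IH[OF that] by (metis rtrancl_subset_rtrancl subsetD)
  show ?case
  proof (cases "v \<in> pverts (diamond n)")
    case False
    then obtain x y b where "v = Mid x y b" "(x, y) \<in> parcs (oriented_diamond n)"
      using Suc.prems by (auto simp: diamond_step_def)
    then show ?thesis
      using 1(4) 2 oriented_diamond_wf[of n]
      by (metis converse_rtrancl_into_rtrancl fst_conv pverts_diamond)
  qed (rule 2)
qed

lemma (in pair_graph) awalk_rev:
  assumes "awalk u p v"
  shows "awalk v (rev (map prod.swap p)) u"
  using assms
proof (induction p arbitrary: u)
  case (Cons e p)
  then have "awalk v (rev (map prod.swap p)) (snd e)" and "e \<in> parcs G" "fst e = u"
    by (auto simp: awalk_Cons_iff)
  moreover from this have "awalk (snd e) [prod.swap e] u"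
    using pair_sym_arcs in_arcsD1 in_arcsD2
    by (cases e) (auto simp: awalk_Cons_iff awalk_Nil_iff symmetric_def sym_def)
  ultimately show ?case by auto
qed (auto simp: awalk_Nil_iff)

lemma (in pair_graph) Metric_space_graph_dist:
  assumes c: "c > 0"
    and reach: "\<And>u v. u \<in> pverts G \<Longrightarrow> v \<in> pverts G \<Longrightarrow> u \<rightarrow>\<^sup>*\<^bsub>G\<^esub> v"
  shows "Metric_space (pverts G) (graph_dist G (\<lambda>_. c))"
proof -
  let ?d = "graph_dist G (\<lambda>_. c)"
  have cost: "awalk_cost (\<lambda>_. c) p = c * real (length p)" for p :: "('a \<times> 'a) list"
    by (induction p) (auto simp: algebra_simps)
  have nn: "\<not> (\<exists>w q. awalk w q w \<and> w \<in> set (pawalk_verts u p) \<and> awalk_cost (\<lambda>_. c) q < 0)" for u p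
    using c by (auto simp: cost not_less)
  have ex: "\<exists>p. awalk u p v \<and> ?d u v = c * real (length p)"
    if uv: "u \<in> pverts G" "v \<in> pverts G" for u v
  proof -
    obtain p where p: "apath u p v" "\<mu> (\<lambda>_. c) u v = awalk_cost (\<lambda>_. c) p"
      using no_neg_cyc_reach_imp_path[OF reach[OF uv]] nn by blast
    then show ?thesis
      by (intro exI[of _ p]) (auto simp: graph_dist_def apath_def cost)
  qed
  have le: "?d u v \<le> c * real (length p)" if "awalk u p v" for u v p
  proof -
    have uv: "u \<in> pverts G" "v \<in> pverts G" using that by auto
    obtain q where q: "apath u q v" "\<mu> (\<lambda>_. c) u v = awalk_cost (\<lambda>_. c) q"
      using no_neg_cyc_reach_imp_path[OF reach[OF uv]] nn by blast
    with min_cost_le_walk_cost[OF that, of "\<lambda>_. c"] show ?thesis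
      by (simp add: graph_dist_def cost)
  qed
  have out: "?d u v = 0" if "u \<notin> pverts G \<or> v \<notin> pverts G" for u v
  proof -
    have "{p. awalk u p v} = {}" using that by auto
    then show ?thesis by (simp add: graph_dist_def \<mu>_def top_ereal_def)
  qed
  show ?thesis
  proof
    show "0 \<le> ?d x y" for x y
      using out ex[of x y] c by (cases "x \<in> pverts G \<and> y \<in> pverts G") auto
    have "?d x y \<le> ?d y x" if "x \<in> pverts G" "y \<in> pverts G" for x y
      using ex[OF that(2,1)] le[OF awalk_rev] by (metis length_map length_rev)
    then show "?d x y = ?d y x" for x y
      using out by (metis order_antisym)
    show "(?d x y = 0) = (x = y)" if "x \<in> pverts G" "y \<in> pverts G" for x y
    proof
      assume "?d x y = 0"
      with ex[OF that] c show "x = y" by (auto simp: awalk_Nil_iff)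
    next
      assume "x = y"
      with that le[of x "[]" x] ex[OF that] c show "?d x y = 0"
        by (auto simp: awalk_Nil_iff mult_le_0_iff)
    qed
    show "?d x z \<le> ?d x y + ?d y z"
      if xyz: "x \<in> pverts G" "y \<in> pverts G" "z \<in> pverts G" for x y z
    proof -
      obtain p q where "awalk x p y" "?d x y = c * real (length p)"
        "awalk y q z" "?d y z = c * real (length q)"
        using ex xyz by metis
      then show ?thesis
        using le[of x "p @ q" z] by (auto simp: algebra_simps)
    qed
  qed
qed

theorem Metric_space_diamond: "Metric_space (pverts (diamond n)) (diamond_dist n)"
proof -
  interpret pair_graph "diamond n" by (rule pair_graph_diamond)
  have sym: "sym ((parcs (diamond n))\<^sup>*)"
    by (intro sym_rtrancl) (auto simp: parcs_diamond sym_def)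
  have "u \<rightarrow>\<^sup>*\<^bsub>diamond n\<^esub> v" if "u \<in> pverts (diamond n)" "v \<in> pverts (diamond n)" for u v
  proof -
    have "(u, v) \<in> (parcs (diamond n))\<^sup>*"
      using diamond_reach_Pole that sym by (meson rtrancl_trans symD)
    then show ?thesis
    proof (induction rule: rtrancl_induct)
      case base
      then show ?case using that by auto
    next
      case (step y z)
      then show ?case by (metis adj_reachable_trans reachable_adj_trans with_proj_simps(3))
    qed
  qed
  then show ?thesis
    unfolding diamond_dist_def by (intro Metric_space_graph_dist) auto
qed

end

theory Submission
  imports Defs
begin

text \<open>
  The idea is that the coordinates of an isometric copy of \<open>\<ell>\<^sub>\<infinity>\<^sup>k\<close> pin down the slopes of optimal
  potentials, while mass put at a single vertex of a diamond graph has only two ways out.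

  Let \<open>T\<close> be a linear isometry of \<open>\<ell>\<^sub>\<infinity>\<^sup>k\<close> into \<open>TC(X)\<close>.  By Kantorovich duality the transportation
  problem \<open>T e\<^sub>i\<close> has an optimal \<open>1\<close>-Lipschitz potential \<open>L\<^sub>i\<close>.  The functional \<open>x \<mapsto> \<Sum>v. L\<^sub>i v * T x v\<close> has
  norm at most \<open>1\<close> on \<open>\<ell>\<^sub>\<infinity>\<^sup>k\<close> and is \<open>1\<close> at \<open>e\<^sub>i\<close>, so it is the \<open>i\<close>-th coordinate.  Hence for every sign
  vector \<open>\<epsilon>\<close>, all of \<open>\<epsilon>\<^sub>1 L\<^sub>1, \<dots>, \<epsilon>\<^sub>k L\<^sub>k\<close> are optimal potentials of the same problem \<open>T \<epsilon>\<close>: an optimal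
  plan moves mass only between points where every \<open>\<epsilon>\<^sub>i L\<^sub>i\<close> drops by the full distance.

  Suppose that a point \<open>a\<close> lies in a set \<open>S\<close> on which all \<open>T x\<close> vanish except at \<open>a\<close>, and that every
  point outside \<open>S\<close> lies on a geodesic from \<open>a\<close> through one of two points \<open>s\<close>, \<open>t\<close> (the gates).  If
  \<open>T \<epsilon> a > 0\<close>, the mass at \<open>a\<close> must leave \<open>S\<close>, hence all \<open>\<epsilon>\<^sub>i L\<^sub>i\<close> drop at full slope from \<open>a\<close> to
  a gate, and \<open>\<epsilon>\<close> is recovered from the gate as the vector of slopes \<open>(L\<^sub>i a - L\<^sub>i p) / d a p\<close>.  So at
  most two sign vectors satisfy \<open>T \<epsilon> a > 0\<close>.  But for \<open>k \<ge> 4\<close> a nonzero linear functional is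
  positive at more than two sign vectors (\<open>sign_vector_avoiding_two\<close>).  This contradiction is
  \<open>two_gates_obstruct_linf\<close>.

  In a diamond graph take for \<open>a\<close> a vertex of highest level in the union of the supports.  If
  \<open>a\<close> was created on the edge \<open>st\<close>, let \<open>S\<close> consist of \<open>a\<close> and all vertices created later inside
  the edges \<open>sa\<close> and \<open>at\<close>; the gates are \<open>s\<close> and \<open>t\<close>.  If \<open>a\<close> is a pole, the other pole is the
  only gate.
\<close>


section \<open>Linearising a sublinear functional\<close>

locale sublinear_on = vector_space scale
  for scale :: "real \<Rightarrow> 'b::ab_group_add \<Rightarrow> 'b" (infixr \<open>\<cdot>\<close> 75) +
  fixes V :: "'b set" and q :: "'b \<Rightarrow> real"
  assumes subspace_V: "subspace V"
    and subadd: "x \<in> V \<Longrightarrow> y \<in> V \<Longrightarrow> q (x + y) \<le> q x + q y"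
    and pos_homogeneous: "x \<in> V \<Longrightarrow> c \<ge> 0 \<Longrightarrow> q (c \<cdot> x) = c * q x"
begin

lemma V_add: "x \<in> V \<Longrightarrow> y \<in> V \<Longrightarrow> x + y \<in> V"
  and V_scale: "x \<in> V \<Longrightarrow> c \<cdot> x \<in> V"
  and V_uminus: "x \<in> V \<Longrightarrow> - x \<in> V"
  and V_zero: "0 \<in> V"
  using subspace_V by (auto intro: subspace_add subspace_scale subspace_neg subspace_0)

lemma q_zero: "q 0 = 0"
  using pos_homogeneous[OF V_zero, of 0] by simp

lemma q_uminus_ge: "x \<in> V \<Longrightarrow> - q (- x) \<le> q x"
  using subadd[of x "- x"] by (simp add: V_uminus q_zero)

text \<open>
  Since \<open>- q (- z) \<le> q z\<close> always holds, \<open>q (- z) \<le> - q z\<close> says that \<open>q\<close> is linear on the line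
  through \<open>z\<close>; subadditivity applied to \<open>z\<close> and to \<open>- z\<close> then makes it additive in that direction.
\<close>

lemma additive_at:
  assumes "z \<in> V" "q (- z) \<le> - q z" "x \<in> V"
  shows "q (z + x) = q z + q x"
  using subadd[of z x] subadd[of "- z" "z + x"] assms by (simp add: V_uminus V_add)

lemma homogeneous_at:
  assumes "z \<in> V" "q (- z) \<le> - q z"
  shows "q (c \<cdot> z) = c * q z"
proof (cases "c \<ge> 0")
  case False
  then have "q ((- c) \<cdot> (- z)) = - c * q (- z)"
    using assms by (intro pos_homogeneous V_uminus) auto
  moreover have "q (- z) = - q z"
    using assms q_uminus_ge[of z] by linarith
  ultimately show ?thesis by simp
qed (simp add: assms pos_homogeneous)

lemma linear_at_combinations:
  assumes "finite F" and Z: "\<And>i. i \<in> F \<Longrightarrow> z i \<in> V \<and> q (- z i) \<le> - q (z i)"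
  shows "(\<Sum>i\<in>F. c i \<cdot> z i) \<in> V \<and> q (\<Sum>i\<in>F. c i \<cdot> z i) = (\<Sum>i\<in>F. c i * q (z i))"
  using assms
proof (induction F)
  case (insert j F)
  have "c j \<cdot> z j \<in> V" "q (- (c j \<cdot> z j)) \<le> - q (c j \<cdot> z j)"
    using insert.prems homogeneous_at[of "z j" "c j"] homogeneous_at[of "z j" "- c j"]
    by (auto intro: V_scale)
  with insert show ?case
    by (simp add: additive_at V_add homogeneous_at)
qed (simp add: V_zero q_zero)

text \<open>
  The finite-dimensional Hahn--Banach theorem is obtained by decreasing \<open>q\<close> rather than by
  extending functionals.  The infimum below is the largest sublinear functional below \<open>q\<close> whose
  value at \<open>- z\<close> is at most \<open>- q z\<close>; any such functional is linear along \<open>z\<close>.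
\<close>

lemma linearize_along:
  assumes z: "z \<in> V"
  shows "\<exists>q'. sublinear_on scale V q' \<and> (\<forall>x\<in>V. q' x \<le> q x) \<and> q' (- z) \<le> - q z"
proof -
  define g where "g x t = q (x + t \<cdot> z) - t * q z" for x t
  define q' where "q' x = (INF t\<in>{0..}. g x t)" for x
  have bound: "- q (- x) \<le> g x t" if "x \<in> V" "t \<ge> 0" for x t
    using subadd[of "x + t \<cdot> z" "- x"] that z pos_homogeneous[of z t]
    by (simp add: g_def V_add V_scale V_uminus)
  have le: "q' x \<le> g x t" if "x \<in> V" "t \<ge> 0" for x t
    unfolding q'_def using bound that
    by (intro cINF_lower) (auto intro!: bdd_belowI[of _ "- q (- x)"])
  have ge: "b \<le> q' x" if "\<And>t. t \<ge> 0 \<Longrightarrow> b \<le> g x t" for b x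
    unfolding q'_def using that by (intro cINF_greatest) auto
  have subadd': "q' (x + y) \<le> q' x + q' y" if "x \<in> V" "y \<in> V" for x y
  proof -
    have "q' (x + y) \<le> g x s + g y t" if "s \<ge> 0" "t \<ge> 0" for s t
    proof -
      have "q' (x + y) \<le> g (x + y) (s + t)"
        using \<open>x \<in> V\<close> \<open>y \<in> V\<close> that by (intro le V_add) auto
      also have "\<dots> \<le> g x s + g y t"
        using subadd[of "x + s \<cdot> z" "y + t \<cdot> z"] \<open>x \<in> V\<close> \<open>y \<in> V\<close> z
        by (simp add: g_def V_add V_scale scale_left_distrib algebra_simps)
      finally show ?thesis .
    qed
    then have "q' (x + y) - g y t \<le> q' x" if "t \<ge> 0" for t
      using that by (intro ge) (simp add: algebra_simps)
    then have "q' (x + y) - q' x \<le> q' y"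
      by (intro ge) (simp add: algebra_simps)
    then show ?thesis by simp
  qed
  have q'0: "q' 0 = 0"
    using le[OF V_zero, of 0] ge[of 0 0] z by (simp add: g_def pos_homogeneous q_zero)
  have scale_ge: "c * q' x \<le> q' (c \<cdot> x)" if "x \<in> V" "c > 0" for x c
  proof (rule ge)
    fix t :: real assume "t \<ge> 0"
    have "c \<cdot> x + t \<cdot> z = c \<cdot> (x + (t / c) \<cdot> z)"
      using \<open>c > 0\<close> by (simp add: scale_right_distrib)
    then have "g (c \<cdot> x) t = c * g x (t / c)"
      using that z by (simp add: g_def pos_homogeneous V_add V_scale right_diff_distrib)
    then show "c * q' x \<le> g (c \<cdot> x) t"
      using le[of x "t / c"] that \<open>t \<ge> 0\<close> by simp
  qed
  have hom': "q' (c \<cdot> x) = c * q' x" if x: "x \<in> V" and c: "c \<ge> 0" for x c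
  proof (cases "c = 0")
    case False
    then have "(1 / c) * q' (c \<cdot> x) \<le> q' x"
      using scale_ge[of "c \<cdot> x" "1 / c"] x c by (simp add: V_scale)
    then have "q' (c \<cdot> x) \<le> c * q' x"
      using False c by (simp add: field_simps)
    with scale_ge[OF x, of c] False c show ?thesis by simp
  qed (simp add: q'0)
  have "sublinear_on scale V q'"
    by unfold_locales (use subspace_V subadd' hom' in auto)
  moreover have "\<forall>x\<in>V. q' x \<le> q x"
    using le[of _ 0] by (simp add: g_def)
  moreover have "q' (- z) \<le> - q z"
    using le[of "- z" 1] z by (simp add: g_def V_uminus q_zero)
  ultimately show ?thesis by blast
qed

end

text \<open>
  Directions may be treated one after another: once \<open>q (- z) \<le> - q z\<close> holds, every smaller
  sublinear functional inherits it.
\<close>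

lemma linearize_on_finite:
  fixes scale :: "real \<Rightarrow> 'b::ab_group_add \<Rightarrow> 'b"
  assumes "finite Z" "Z \<subseteq> V" "sublinear_on scale V p"
  shows "\<exists>q. sublinear_on scale V q \<and> (\<forall>x\<in>V. q x \<le> p x) \<and> (\<forall>z\<in>Z. q (- z) \<le> - q z)"
  using assms
proof (induction Z)
  case (insert z Z)
  then obtain q where q: "sublinear_on scale V q" "\<forall>x\<in>V. q x \<le> p x" "\<forall>z\<in>Z. q (- z) \<le> - q z"
    by auto
  obtain q' where q': "sublinear_on scale V q'" "\<forall>x\<in>V. q' x \<le> q x" "q' (- z) \<le> - q z"
    using sublinear_on.linearize_along[OF q(1)] insert.prems(1) by blast
  have "q' (- w) \<le> - q' w" if "w \<in> insert z Z" for w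
  proof -
    have "w \<in> V" "- w \<in> V"
      using that insert.prems(1) sublinear_on.V_uminus[OF q(1)] by auto
    then have "q' w \<le> q w" "q' (- w) \<le> q (- w)"
      using q'(2) by auto
    with that q(3) q'(3) show ?thesis by force
  qed
  moreover have "\<forall>x\<in>V. q' x \<le> p x"
    using q(2) q'(2) by force
  ultimately show ?case using q'(1) by blast
qed auto


section \<open>Transport plans and their costs\<close>

definition dipole :: "'a \<Rightarrow> 'a \<Rightarrow> 'a \<Rightarrow> real" where
  "dipole x y = (\<lambda>u. indicator {x} u - indicator {y} u)"

definition transport_costs :: "'a set \<Rightarrow> ('a \<Rightarrow> 'a \<Rightarrow> real) \<Rightarrow> ('a \<Rightarrow> real) \<Rightarrow> real set" where
  "transport_costs X d f =
     {\<Sum>i<m. a i * d (x i) (y i) | (m :: nat) a x y.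
        (\<forall>i<m. 0 \<le> a i \<and> x i \<in> X \<and> y i \<in> X) \<and> (\<forall>u. f u = (\<Sum>i<m. a i * dipole (x i) (y i) u))}"

lemma TC_norm_eq_Inf: "TC_norm X d f = Inf (transport_costs X d f)"
  by (simp add: TC_norm_def transport_costs_def dipole_def)

lemma sum_fun_apply: "(\<Sum>i\<in>I. g i) x = (\<Sum>i\<in>I. g i x)"
  by (induction I rule: infinite_finite_induct) auto

lemma dipole_in_TC: "finite X \<Longrightarrow> x \<in> X \<Longrightarrow> y \<in> X \<Longrightarrow> dipole x y \<in> TC X"
  by (auto simp: TC_def dipole_def sum_subtractf indicator_def)

lemma TC_eq_sum_dipoles:
  assumes "finite X" "f \<in> TC X" "w \<in> X"
  shows "f = (\<Sum>v\<in>X. fscale (f v) (dipole v w))"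
proof
  fix u
  have "(\<Sum>v\<in>X. fscale (f v) (dipole v w)) u
      = (\<Sum>v\<in>X. if u = v then f v else 0) - (\<Sum>v\<in>X. f v) * indicator {w} u"
    by (auto simp: sum_fun_apply fscale_def dipole_def right_diff_distrib sum_subtractf
        sum_distrib_right indicator_def intro!: sum.cong)
  also have "\<dots> = f u"
    using assms by (auto simp: TC_def)
  finally show "f u = (\<Sum>v\<in>X. fscale (f v) (dipole v w)) u" ..
qed

lemma sum_lessThan_append:
  fixes g h :: "nat \<Rightarrow> real"
  shows "(\<Sum>i<m + n. if i < m then g i else h (i - m)) = (\<Sum>i<m. g i) + (\<Sum>i<n. h i)"
  by (induction n) auto

lemma transport_costs_add:
  assumes "r \<in> transport_costs X d f" "s \<in> transport_costs X d g"
  shows "r + s \<in> transport_costs X d (f + g)"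
proof -
  obtain m :: nat and a x y where 1: "\<forall>i<m. 0 \<le> a i \<and> x i \<in> X \<and> y i \<in> X"
    "\<forall>u. f u = (\<Sum>i<m. a i * dipole (x i) (y i) u)" "r = (\<Sum>i<m. a i * d (x i) (y i))"
    using assms(1) unfolding transport_costs_def by blast
  obtain n :: nat and b v w where 2: "\<forall>i<n. 0 \<le> b i \<and> v i \<in> X \<and> w i \<in> X"
    "\<forall>u. g u = (\<Sum>i<n. b i * dipole (v i) (w i) u)" "s = (\<Sum>i<n. b i * d (v i) (w i))"
    using assms(2) unfolding transport_costs_def by blast
  let ?j = "\<lambda>p q i. if i < m then p i else q (i - m)"
  have eq: "(\<Sum>i<m + n. ?j a b i * h (?j x v i) (?j y w i))
      = (\<Sum>i<m. a i * h (x i) (y i)) + (\<Sum>i<n. b i * h (v i) (w i))" for h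
    by (subst sum_lessThan_append[symmetric]) (intro sum.cong, auto)
  show ?thesis
    unfolding transport_costs_def
  proof (intro CollectI exI conjI)
    show "r + s = (\<Sum>i<m + n. ?j a b i * d (?j x v i) (?j y w i))"
      using 1 2 by (simp add: eq)
    show "\<forall>u. (f + g) u = (\<Sum>i<m + n. ?j a b i * dipole (?j x v i) (?j y w i) u)"
      using 1 2 eq[of "\<lambda>p q. dipole p q u" for u] by simp
    show "\<forall>i<m + n. 0 \<le> ?j a b i \<and> ?j x v i \<in> X \<and> ?j y w i \<in> X"
      using 1 2 by auto
  qed
qed

lemma transport_costs_fscale:
  assumes "r \<in> transport_costs X d f" "c \<ge> 0"
  shows "c * r \<in> transport_costs X d (fscale c f)"
proof -
  obtain m :: nat and a x y where 1: "\<forall>i<m. 0 \<le> a i \<and> x i \<in> X \<and> y i \<in> X"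
    "\<forall>u. f u = (\<Sum>i<m. a i * dipole (x i) (y i) u)" "r = (\<Sum>i<m. a i * d (x i) (y i))"
    using assms(1) unfolding transport_costs_def by blast
  show ?thesis
    unfolding transport_costs_def
  proof (intro CollectI exI conjI)
    show "c * r = (\<Sum>i<m. (c * a i) * d (x i) (y i))"
      using 1 by (simp add: sum_distrib_left mult.assoc)
    show "\<forall>u. fscale c f u = (\<Sum>i<m. (c * a i) * dipole (x i) (y i) u)"
      using 1 by (simp add: fscale_def sum_distrib_left mult.assoc)
    show "\<forall>i<m. 0 \<le> c * a i \<and> x i \<in> X \<and> y i \<in> X"
      using 1 assms(2) by auto
  qed
qed

lemma transport_costs_dipole:
  assumes "x \<in> X" "y \<in> X"
  shows "d x y \<in> transport_costs X d (dipole x y)"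
  unfolding transport_costs_def
  by (intro CollectI exI[of _ 1] exI[of _ "\<lambda>_. 1"] exI[of _ "\<lambda>_. x"] exI[of _ "\<lambda>_. y"])
    (simp add: assms)

lemma transport_costs_zero: "0 \<in> transport_costs X d 0"
  unfolding transport_costs_def by (intro CollectI exI[of _ 0]) simp

lemma transport_costs_nonempty:
  assumes X: "finite X" and f: "f \<in> TC X"
  shows "transport_costs X d f \<noteq> {}"
proof (cases "X = {}")
  case True
  then have "f = 0" using f by (auto simp: TC_def fun_eq_iff)
  then show ?thesis using transport_costs_zero by blast
next
  case False
  then obtain w where w: "w \<in> X" by blast
  have "\<exists>r. r \<in> transport_costs X d (fscale c (dipole v w))" if "v \<in> X" for v c
  proof (cases "c \<ge> 0")
    case True
    then show ?thesis
      using transport_costs_fscale transport_costs_dipole that w by metis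
  next
    case False
    have "fscale c (dipole v w) = fscale (- c) (dipole w v)"
      by (simp add: fscale_def dipole_def algebra_simps)
    then show ?thesis
      using transport_costs_fscale[OF transport_costs_dipole[OF w that], of "- c"] False by auto
  qed
  note term_cost = this
  have "\<exists>r. r \<in> transport_costs X d (\<Sum>v\<in>F. fscale (f v) (dipole v w))" if "F \<subseteq> X" for F
    using finite_subset[OF that X] that
  proof (induction F)
    case empty
    show ?case using transport_costs_zero by (metis sum.empty)
  next
    case (insert v F)
    then obtain r s where "r \<in> transport_costs X d (fscale (f v) (dipole v w))"
      "s \<in> transport_costs X d (\<Sum>v\<in>F. fscale (f v) (dipole v w))"
      using term_cost[of v "f v"] by auto
    then have "r + s \<in> transport_costs X d (\<Sum>v\<in>insert v F. fscale (f v) (dipole v w))"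
      using transport_costs_add insert.hyps by simp
    then show ?case by blast
  qed
  from this[of X] show ?thesis
    using TC_eq_sum_dipoles[OF X f w] by auto
qed


section \<open>Kantorovich duality\<close>

context Metric_space
begin

text \<open>Exchanging the two points shows that this is the \<open>1\<close>-Lipschitz condition.\<close>

definition nonexpansive :: "('a \<Rightarrow> real) \<Rightarrow> bool" where
  "nonexpansive L \<longleftrightarrow> (\<forall>x\<in>M. \<forall>y\<in>M. L x - L y \<le> d x y)"

lemma transport_costs_nonneg: "r \<in> transport_costs M d f \<Longrightarrow> 0 \<le> r"
  by (auto simp: transport_costs_def intro!: sum_nonneg)

lemma TC_norm_le: "r \<in> transport_costs M d f \<Longrightarrow> TC_norm M d f \<le> r"
  unfolding TC_norm_eq_Inf
  by (intro cInf_lower) (auto intro!: bdd_belowI transport_costs_nonneg)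

lemma le_TC_normI:
  assumes "finite M" "f \<in> TC M" "\<And>r. r \<in> transport_costs M d f \<Longrightarrow> b \<le> r"
  shows "b \<le> TC_norm M d f"
  unfolding TC_norm_eq_Inf
  using assms by (intro cInf_greatest transport_costs_nonempty) auto

lemma sublinear_TC_norm:
  assumes M: "finite M"
  shows "sublinear_on fscale (TC M) (TC_norm M d)"
proof unfold_locales
  show "fun_space.subspace (TC M)" by (rule subspace_TC)
  then have sub: "f + g \<in> TC M" "fscale c f \<in> TC M" if "f \<in> TC M" "g \<in> TC M" for f g c
    using that by (auto intro: fun_space.subspace_add fun_space.subspace_scale)
  show "TC_norm M d (f + g) \<le> TC_norm M d f + TC_norm M d g"
    if fg: "f \<in> TC M" "g \<in> TC M" for f g
  proof -
    have "TC_norm M d (f + g) - s \<le> TC_norm M d f" if "s \<in> transport_costs M d g" for s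
      using TC_norm_le[OF transport_costs_add[OF _ that]]
      by (intro le_TC_normI M fg) (simp add: algebra_simps)
    then have "TC_norm M d (f + g) - TC_norm M d f \<le> TC_norm M d g"
      by (intro le_TC_normI M fg) (simp add: algebra_simps)
    then show ?thesis by simp
  qed
  have le: "TC_norm M d (fscale c f) \<le> c * TC_norm M d f" if "f \<in> TC M" "c > 0" for f c
  proof -
    have "TC_norm M d (fscale c f) / c \<le> TC_norm M d f"
      using TC_norm_le[OF transport_costs_fscale[of _ _ _ f c]] that
      by (intro le_TC_normI M) (auto simp: field_simps)
    then show ?thesis using that by (simp add: field_simps)
  qed
  show "TC_norm M d (fscale c f) = c * TC_norm M d f" if f: "f \<in> TC M" and c: "c \<ge> 0" for f c
  proof (cases "c = 0")
    case True
    have "TC_norm M d 0 \<le> 0" by (intro TC_norm_le transport_costs_zero)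
    moreover have "0 \<le> TC_norm M d 0"
      by (intro le_TC_normI M transport_costs_nonneg fun_space.subspace_0 subspace_TC)
    ultimately show ?thesis using True by simp
  next
    case False
    have "fscale (1 / c) (fscale c f) = f"
      using False by (simp add: fscale_def)
    then have "TC_norm M d f \<le> (1 / c) * TC_norm M d (fscale c f)"
      using le[of "fscale c f" "1 / c"] sub[OF f f] False c by simp
    then have "c * TC_norm M d f \<le> TC_norm M d (fscale c f)"
      using False c by (simp add: field_simps)
    with le[OF f, of c] False c show ?thesis by simp
  qed
qed

lemma potential_le_TC_norm:
  assumes M: "finite M" and L: "nonexpansive L" and f: "f \<in> TC M"
  shows "(\<Sum>v\<in>M. L v * f v) \<le> TC_norm M d f"
proof (rule le_TC_normI[OF M f])
  fix r assume "r \<in> transport_costs M d f"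
  then obtain m :: nat and a x y where 1: "\<forall>i<m. 0 \<le> a i \<and> x i \<in> M \<and> y i \<in> M"
    "\<forall>u. f u = (\<Sum>i<m. a i * dipole (x i) (y i) u)" "r = (\<Sum>i<m. a i * d (x i) (y i))"
    unfolding transport_costs_def by blast
  have "(\<Sum>v\<in>M. L v * dipole p q v) = L p - L q" if "p \<in> M" "q \<in> M" for p q
    using M that by (simp add: dipole_def indicator_def right_diff_distrib sum_subtractf
        if_distrib[of "\<lambda>c. _ * c"] cong: if_cong)
  then have "(\<Sum>i<m. a i * (\<Sum>v\<in>M. L v * dipole (x i) (y i) v))
      \<le> (\<Sum>i<m. a i * d (x i) (y i))"
    using L 1(1) by (intro sum_mono) (auto simp: nonexpansive_def intro!: mult_left_mono)
  also have "(\<Sum>i<m. a i * (\<Sum>v\<in>M. L v * dipole (x i) (y i) v)) = (\<Sum>v\<in>M. L v * f v)"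
    unfolding 1(2)[rule_format] sum_distrib_left
    by (subst sum.swap) (simp add: mult_ac)
  finally show "(\<Sum>v\<in>M. L v * f v) \<le> r" using 1(3) by simp
qed

text \<open>
  The norm is first made linear along \<open>f\<close>, which keeps its value there, and then along the
  dipoles \<open>\<one>\<^sub>v - \<one>\<^sub>w\<close> for a base point \<open>w\<close>, which span the space.  The resulting linear functional is
  integration against its values on these dipoles.
\<close>

theorem Kantorovich_potential_exists:
  assumes M: "finite M" and f: "f \<in> TC M"
  shows "\<exists>L. nonexpansive L \<and> (\<Sum>v\<in>M. L v * f v) = TC_norm M d f"
proof (cases "M = {}")
  case True
  then have "f = 0" using f by (auto simp: TC_def fun_eq_iff)
  then have "TC_norm M d f = 0"
    using sublinear_on.q_zero[OF sublinear_TC_norm[OF M]] by simp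
  moreover have "nonexpansive (\<lambda>_. 0)"
    by (simp add: nonexpansive_def)
  ultimately show ?thesis using True by auto
next
  case False
  then obtain w where w: "w \<in> M" by blast
  note sub = sublinear_TC_norm[OF M]
  obtain q\<^sub>0 where q0: "sublinear_on fscale (TC M) q\<^sub>0" "\<forall>g\<in>TC M. q\<^sub>0 g \<le> TC_norm M d g"
    "q\<^sub>0 (- f) \<le> - TC_norm M d f"
    using sublinear_on.linearize_along[OF sub f] by blast
  let ?Z = "(\<lambda>v. dipole v w) ` M"
  have "finite ?Z" "?Z \<subseteq> TC M"
    using M w by (auto intro: dipole_in_TC)
  then obtain q where q: "sublinear_on fscale (TC M) q" "\<forall>g\<in>TC M. q g \<le> q\<^sub>0 g"
    "\<forall>z\<in>?Z. q (- z) \<le> - q z"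
    using linearize_on_finite[OF _ _ q0(1)] by blast
  interpret q: sublinear_on fscale "TC M" q by (rule q(1))
  have q_le: "q g \<le> TC_norm M d g" if "g \<in> TC M" for g
    using q(2) q0(2) that by force
  define L where "L v = q (dipole v w)" for v
  have z: "dipole v w \<in> TC M \<and> q (- dipole v w) \<le> - q (dipole v w)" if "v \<in> M" for v
    using that q(3) M w by (auto intro: dipole_in_TC)
  have "L x - L y \<le> d x y" if "x \<in> M" "y \<in> M" for x y
  proof -
    have "dipole y w + dipole x y = dipole x w"
      by (simp add: dipole_def fun_eq_iff)
    then have "L x = L y + q (dipole x y)"
      using q.additive_at[of "dipole y w" "dipole x y"] z that dipole_in_TC[OF M]
      by (simp add: L_def)
    also have "q (dipole x y) \<le> d x y"
      using q_le[of "dipole x y"] TC_norm_le[OF transport_costs_dipole, of x y] that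
        dipole_in_TC[OF M] by fastforce
    finally show ?thesis by simp
  qed
  then have L: "nonexpansive L" by (simp add: nonexpansive_def)
  have "q (\<Sum>v\<in>M. fscale (f v) (dipole v w)) = (\<Sum>v\<in>M. f v * L v)"
    using q.linear_at_combinations[OF M, of "\<lambda>v. dipole v w" f] z by (simp add: L_def)
  then have "q f = (\<Sum>v\<in>M. L v * f v)"
    using TC_eq_sum_dipoles[OF M f w] by (simp add: mult.commute)
  moreover have "TC_norm M d f \<le> q f"
  proof -
    have "q (- f) \<le> - TC_norm M d f"
      using q(2) q0(3) q.V_uminus[OF f] by force
    then show ?thesis using q.q_uminus_ge[OF f] by linarith
  qed
  ultimately show ?thesis
    using L potential_le_TC_norm[OF M L f] by force
qed

text \<open>
  Complementary slackness without an optimal plan: if no pair leaving \<open>R\<close> were tight, the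
  potential could be raised by a constant on all of \<open>R\<close>, and since \<open>R\<close> carries positive total mass
  this would exceed the norm.
\<close>

lemma tight_pair_leaving:
  assumes M: "finite M" and L: "nonexpansive L" and f: "f \<in> TC M"
    and opt: "(\<Sum>v\<in>M. L v * f v) = TC_norm M d f"
    and R: "R \<subseteq> M" "(\<Sum>v\<in>R. f v) > 0"
  shows "\<exists>x\<in>R. \<exists>y\<in>M - R. L x - L y = d x y"
proof (rule ccontr)
  assume no: "\<not> ?thesis"
  let ?P = "R \<times> (M - R)"
  have P: "finite ?P" using M R(1) by (auto intro: finite_subset)
  have "\<exists>c>0. \<forall>(x, y)\<in>?P. L x - L y + c \<le> d x y"
  proof (cases "?P = {}")
    case False
    \<comment> \<open>the smallest slack; positive because there are only finitely many pairs\<close>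
    define c where "c = Min ((\<lambda>(x, y). d x y - (L x - L y)) ` ?P)"
    have "c \<in> (\<lambda>(x, y). d x y - (L x - L y)) ` ?P"
      unfolding c_def using P False by (intro Min_in) blast+
    then obtain x y where "x \<in> R" "y \<in> M - R" "c = d x y - (L x - L y)"
      by (elim imageE SigmaE) simp
    moreover from this have "L x - L y \<le> d x y" "L x - L y \<noteq> d x y"
      using L no R(1) by (auto simp: nonexpansive_def)
    ultimately have "c > 0" by simp
    moreover have "L x - L y + c \<le> d x y" if "(x, y) \<in> ?P" for x y
    proof -
      have "c \<le> d x y - (L x - L y)"
        unfolding c_def using P that by (intro Min_le) force+
      then show ?thesis by simp
    qed
    ultimately show ?thesis by blast
  qed (auto intro: exI[of _ 1])
  then obtain c where c: "c > 0" "\<And>x y. x \<in> R \<Longrightarrow> y \<in> M - R \<Longrightarrow> L x - L y + c \<le> d x y"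
    by auto
  define L' where "L' v = L v + c * indicator R v" for v
  have "L' x - L' y \<le> d x y" if "x \<in> M" "y \<in> M" for x y
  proof -
    have "L x - L y \<le> d x y" using L that by (auto simp: nonexpansive_def)
    then show ?thesis
      using c(1) c(2)[of x y] that by (auto simp: L'_def indicator_def)
  qed
  then have "(\<Sum>v\<in>M. L' v * f v) \<le> TC_norm M d f"
    by (intro potential_le_TC_norm M f) (simp add: nonexpansive_def)
  also have "(\<Sum>v\<in>M. L' v * f v) = (\<Sum>v\<in>M. L v * f v) + c * (\<Sum>v\<in>M. indicator R v * f v)"
    by (simp add: L'_def distrib_right sum.distrib sum_distrib_left mult.assoc)
  also have "(\<Sum>v\<in>M. indicator R v * f v) = (\<Sum>v\<in>R. f v)"
    using M R(1) by (simp add: indicator_def sum.inter_restrict[symmetric] Int_absorb1 if_distrib[of "\<lambda>c. c * _"] cong: if_cong)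
  finally show False
    using opt mult_pos_pos[OF c(1) R(2)] by linarith
qed

end


section \<open>Coordinates and sign vectors of the maximum norm\<close>

lemma infnorm_le_cart:
  fixes x :: "real ^ 'k::finite"
  assumes "\<And>i. \<bar>x $ i\<bar> \<le> b"
  shows "infnorm x \<le> b"
  unfolding infnorm_cart using assms by (intro cSup_least) auto

text \<open>
  The unit ball is a cube and \<open>e\<^sub>i\<close> is the centre of a facet.  A functional of norm at most \<open>1\<close> with
  value \<open>1\<close> at \<open>e\<^sub>i\<close> cannot vary on this facet: moving by \<open>y\<close> and by \<open>- y\<close> both stay in the ball.
\<close>

lemma coordinate_functional_unique:
  fixes \<phi> :: "real ^ 'k::finite \<Rightarrow> real"
  assumes lin: "linear \<phi>" and le: "\<And>x. \<phi> x \<le> infnorm x" and i: "\<phi> (axis i 1) = 1"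
  shows "\<phi> x = x $ i"
proof -
  define y where "y = x - (x $ i) *\<^sub>R axis i 1"
  define m where "m = infnorm y"
  have "y $ i = 0" by (simp add: y_def)
  have "infnorm (m *\<^sub>R axis i 1 + \<sigma> *\<^sub>R y) \<le> m" if "\<bar>\<sigma>\<bar> = 1" for \<sigma>
  proof (rule infnorm_le_cart)
    fix j
    have "\<bar>y $ j\<bar> \<le> m" "m \<ge> 0"
      using component_le_infnorm_cart[of y j] by (auto simp: m_def infnorm_pos_le)
    with \<open>y $ i = 0\<close> that show "\<bar>(m *\<^sub>R axis i 1 + \<sigma> *\<^sub>R y) $ j\<bar> \<le> m"
      by (cases "j = i") (auto simp: axis_def abs_mult)
  qed
  then have "m + \<sigma> * \<phi> y \<le> m" if "\<bar>\<sigma>\<bar> = 1" for \<sigma>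
    using le[of "m *\<^sub>R axis i 1 + \<sigma> *\<^sub>R y"] that i
    by (fastforce simp: linear_add[OF lin] linear_scale[OF lin])
  from this[of 1] this[of "-1"] have "\<phi> y = 0" by simp
  then show ?thesis
    by (simp add: y_def linear_diff[OF lin] linear_scale[OF lin] i)
qed

text \<open>
  Let \<open>g e\<^sub>i \<noteq> 0\<close>.  Fix the sign of coordinate \<open>i\<close> to be that of \<open>g e\<^sub>i\<close> and let \<open>\<delta>\<close> carry the other
  signs: the values of \<open>g\<close> at the sign vectors given by \<open>\<delta>\<close> and by \<open>- \<delta>\<close> add up to \<open>2 \<bar>g e\<^sub>i\<bar> > 0\<close>, so
  one of them is positive.  It is not known which one, so both have to avoid \<open>r\<close> and \<open>r'\<close>.  This is
  achieved through products of two coordinates, which do not change under \<open>\<delta> \<mapsto> - \<delta>\<close>: the product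
  of the signs \<open>j\<close>, \<open>k\<close> is chosen different from that of \<open>r\<close>, and the product of \<open>j\<close>, \<open>l\<close> different
  from that of \<open>r'\<close>.  Hence the need for three coordinates besides \<open>i\<close>.
\<close>

lemma sign_vector_avoiding_two:
  fixes g :: "real ^ 'k::finite \<Rightarrow> real"
  assumes k: "CARD('k) \<ge> 4" and lin: "linear g" and nz: "g x \<noteq> 0"
  shows "\<exists>\<epsilon>. (\<forall>i. \<bar>\<epsilon> $ i\<bar> = 1) \<and> g \<epsilon> > 0 \<and> \<epsilon> \<noteq> r \<and> \<epsilon> \<noteq> r'"
proof -
  have "\<exists>i. g (axis i 1) \<noteq> 0"
  proof (rule ccontr)
    assume "\<not> ?thesis"
    then have "g (\<Sum>i\<in>UNIV. (x $ i) *\<^sub>R axis i 1) = 0"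
      by (simp add: linear_sum[OF lin] linear_scale[OF lin])
    moreover have "(\<Sum>i\<in>UNIV. (x $ i) *\<^sub>R axis i 1) = x"
      using basis_expansion[of x] by (simp add: scalar_mult_eq_scaleR)
    ultimately show False using nz by simp
  qed
  then obtain i where i: "g (axis i 1) \<noteq> 0" ..
  have "card (UNIV - {i}) \<ge> 3" using k by simp
  then obtain A where "A \<subseteq> UNIV - {i}" "card A = 3"
    by (meson obtain_subset_with_card_n)
  then obtain j k l where jkl: "j \<noteq> i" "k \<noteq> i" "l \<noteq> i" "j \<noteq> k" "j \<noteq> l" "k \<noteq> l"
    by (auto simp: card_3_iff)
  define \<kappa> where "\<kappa> = (if r $ j * r $ k = 1 then -1 else 1 :: real)"
  define \<mu> where "\<mu> = (if r' $ j * r' $ l = 1 then -1 else 1 :: real)"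
  define \<delta> :: "real ^ 'k" where
    "\<delta> = (\<chi> m. if m = i then 0 else if m = k then \<kappa> else if m = l then \<mu> else 1)"
  define \<sigma> where "\<sigma> = sgn (g (axis i 1))"
  define \<epsilon> where "\<epsilon> \<tau> = \<sigma> *\<^sub>R axis i 1 + \<tau> *\<^sub>R \<delta>" for \<tau>
  have "g (\<epsilon> 1) + g (\<epsilon> (-1)) = 2 * \<bar>g (axis i 1)\<bar>"
    by (simp add: \<epsilon>_def \<sigma>_def linear_add[OF lin] linear_scale[OF lin] linear_neg[OF lin]
        linear_diff[OF lin] abs_sgn mult.commute)
  then have "g (\<epsilon> 1) > 0 \<or> g (\<epsilon> (-1)) > 0"
    using i by linarith
  then obtain \<tau> where \<tau>: "\<bar>\<tau>\<bar> = 1" "g (\<epsilon> \<tau>) > 0"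
    by (metis abs_1 abs_minus)
  have "\<tau> * \<tau> = 1" using \<tau>(1) by (metis abs_mult_self mult_1)
  have "\<bar>\<kappa>\<bar> = 1" "\<bar>\<mu>\<bar> = 1" "\<bar>\<sigma>\<bar> = 1"
    using i by (auto simp: \<kappa>_def \<mu>_def \<sigma>_def abs_sgn_eq)
  then have "\<forall>m. \<bar>\<epsilon> \<tau> $ m\<bar> = 1"
    using \<tau>(1) by (simp add: \<epsilon>_def \<delta>_def axis_def abs_mult)
  moreover have "\<epsilon> \<tau> $ j * \<epsilon> \<tau> $ k = \<kappa>" "\<epsilon> \<tau> $ j * \<epsilon> \<tau> $ l = \<mu>"
    using jkl \<open>\<tau> * \<tau> = 1\<close> by (auto simp: \<epsilon>_def \<delta>_def axis_def)
  then have "\<epsilon> \<tau> \<noteq> r" "\<epsilon> \<tau> \<noteq> r'"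
    by (auto simp: \<kappa>_def \<mu>_def split: if_splits)
  ultimately show ?thesis using \<tau>(2) by blast
qed


section \<open>Two gates obstruct the maximum norm\<close>

context Metric_space
begin

lemma nonexpansive_mult_le:
  assumes "nonexpansive L" "\<bar>\<sigma>\<bar> = 1" "x \<in> M" "y \<in> M"
  shows "\<sigma> * (L x - L y) \<le> d x y"
  using assms commute[of x y] unfolding nonexpansive_def
  by (cases "\<sigma> = 1") (fastforce simp: abs_if split: if_splits)+

lemma coordinate_potentials_exist:
  fixes T :: "real ^ 'k::finite \<Rightarrow> 'a \<Rightarrow> real"
  assumes M: "finite M" and lin: "Vector_Spaces.linear (*\<^sub>R) fscale T"
    and TC: "\<And>x. T x \<in> TC M" and iso: "\<And>x. TC_norm M d (T x) = infnorm x"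
  shows "\<exists>L. nonexpansive L \<and> (\<forall>x. (\<Sum>v\<in>M. L v * T x v) = x $ i)"
proof -
  obtain L where L: "nonexpansive L"
    "(\<Sum>v\<in>M. L v * T (axis i 1) v) = TC_norm M d (T (axis i 1))"
    using Kantorovich_potential_exists[OF M TC] by blast
  let ?\<phi> = "\<lambda>x. \<Sum>v\<in>M. L v * T x v"
  have lin': "linear ?\<phi>"
    by (intro linearI) (auto simp: Vector_Spaces.linear_iff[THEN iffD1, OF lin] fscale_def
        distrib_left sum.distrib sum_distrib_left mult_ac)
  have le: "?\<phi> x \<le> infnorm x" for x
    using potential_le_TC_norm[OF M L(1) TC] iso by metis
  have "infnorm (axis i 1 :: real ^ 'k) = 1"
    using component_le_infnorm_cart[of "axis i 1 :: real ^ 'k" i]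
      infnorm_le_cart[of "axis i 1 :: real ^ 'k" 1] by (auto simp: axis_def)
  then have "?\<phi> (axis i 1) = 1"
    unfolding L(2) iso .
  from coordinate_functional_unique[OF lin' le this] L(1) show ?thesis by blast
qed

text \<open>
  The mean \<open>K\<close> of the functions \<open>\<epsilon>\<^sub>i L\<^sub>i\<close> stands for all of them at once: it is itself an optimal
  potential of \<open>T \<epsilon>\<close>, and a mean of numbers bounded by the distance equals the distance only if each
  of them does.
\<close>

theorem two_gates_obstruct_linf:
  fixes W :: "('a \<Rightarrow> real) set"
  assumes M: "finite M" and k: "CARD('k::finite) \<ge> 4"
    and W: "W \<subseteq> TC M" "isometric_to_linf TYPE('k) W (TC_norm M d)"
    and a: "a \<in> M" "a \<in> S" "f \<in> W" "f a \<noteq> 0"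
    and zero: "\<And>g v. g \<in> W \<Longrightarrow> v \<in> S - {a} \<Longrightarrow> g v = 0"
    and gates: "\<And>y. y \<in> M - S \<Longrightarrow> \<exists>p\<in>{s, t}. p \<in> M \<and> p \<noteq> a \<and> d a y = d a p + d p y"
  shows False
proof -
  obtain T :: "real ^ 'k \<Rightarrow> 'a \<Rightarrow> real" where T: "Vector_Spaces.linear (*\<^sub>R) fscale T"
    "bij_betw T UNIV W" "\<And>x. TC_norm M d (T x) = infnorm x"
    using W(2) unfolding isometric_to_linf_def by blast
  have TW: "T x \<in> W" for x using T(2) by (auto simp: bij_betw_def)
  then have TC: "T x \<in> TC M" for x using W(1) by blast
  have "\<exists>L. \<forall>i. nonexpansive (L i) \<and> (\<forall>x. (\<Sum>v\<in>M. L i v * T x v) = x $ i)"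
    using coordinate_potentials_exist[OF M T(1) TC T(3)] by metis
  then obtain L where L: "\<And>i. nonexpansive (L i)"
    "\<And>i x. (\<Sum>v\<in>M. L i v * T x v) = x $ i" by blast
  define slope :: "'a \<Rightarrow> real ^ 'k" where "slope p = (\<chi> i. (L i a - L i p) / d a p)" for p
  have "linear (\<lambda>x. T x a)"
    by (intro linearI) (auto simp: Vector_Spaces.linear_iff[THEN iffD1, OF T(1)] fscale_def)
  moreover obtain x where "T x a \<noteq> 0"
    using a(3,4) bij_betw_imp_surj_on[OF T(2)] by (metis imageE)
  ultimately obtain \<epsilon> where \<epsilon>: "\<And>i. \<bar>\<epsilon> $ i\<bar> = 1" "T \<epsilon> a > 0" "\<epsilon> \<noteq> slope s" "\<epsilon> \<noteq> slope t"
    using sign_vector_avoiding_two[OF k, of "\<lambda>x. T x a" x "slope s" "slope t"] by auto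
  let ?n = "real CARD('k)"
  define K where "K v = (\<Sum>i\<in>UNIV. \<epsilon> $ i * L i v) / ?n" for v
  have n: "?n > 0" using k by simp
  have K_diff: "?n * (K x - K y) = (\<Sum>i\<in>UNIV. \<epsilon> $ i * (L i x - L i y))" for x y
    using n by (simp add: K_def right_diff_distrib sum_subtractf)
  have "?n * (K x - K y) \<le> ?n * d x y" if "x \<in> M" "y \<in> M" for x y
    unfolding K_diff
    using sum_mono[of UNIV "\<lambda>i. \<epsilon> $ i * (L i x - L i y)" "\<lambda>_. d x y"]
      nonexpansive_mult_le[OF L(1) \<epsilon>(1) that] by simp
  then have K: "nonexpansive K"
    using n by (simp add: nonexpansive_def)
  have K_le: "K x - K y \<le> d x y" if "x \<in> M" "y \<in> M" for x y
    using K that by (auto simp: nonexpansive_def)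
  have "?n * (\<Sum>v\<in>M. K v * T \<epsilon> v) = (\<Sum>v\<in>M. \<Sum>i\<in>UNIV. \<epsilon> $ i * (L i v * T \<epsilon> v))"
    using n by (simp add: K_def flip: sum_divide_distrib)
      (simp add: sum_distrib_left sum_distrib_right mult.assoc sum_divide_distrib)
  also have "\<dots> = (\<Sum>i\<in>UNIV. \<epsilon> $ i * (\<Sum>v\<in>M. L i v * T \<epsilon> v))"
    by (subst sum.swap) (simp add: sum_distrib_left)
  also have "\<dots> = (\<Sum>i\<in>(UNIV :: 'k set). 1)"
    unfolding L(2) using \<epsilon>(1) by (intro sum.cong) (metis abs_mult_self mult_1)+
  finally have "(\<Sum>v\<in>M. K v * T \<epsilon> v) = 1"
    using n by simp
  moreover have "infnorm \<epsilon> = 1"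
    using component_le_infnorm_cart[of \<epsilon> undefined] infnorm_le_cart[of \<epsilon> 1] \<epsilon>(1) by simp
  ultimately have opt: "(\<Sum>v\<in>M. K v * T \<epsilon> v) = TC_norm M d (T \<epsilon>)"
    using T(3) by simp
  \<comment> \<open>The points of \<open>S\<close> that mass from \<open>a\<close> can reach at full slope; their total mass is that of \<open>a\<close>,
    so some of it must move on, and it cannot stay in \<open>S\<close>.\<close>
  define R where "R = {v \<in> M \<inter> S. K a - K v = d a v}"
  have R: "R \<subseteq> M" "a \<in> R" "finite R"
    using a(1,2) M by (auto simp: R_def)
  have "(\<Sum>v\<in>R - {a}. T \<epsilon> v) = 0"
    using zero[OF TW] by (intro sum.neutral) (auto simp: R_def)
  then have "(\<Sum>v\<in>R. T \<epsilon> v) > 0"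
    using R \<epsilon>(2) by (simp add: sum.remove)
  then obtain x y where xy: "x \<in> R" "y \<in> M - R" "K x - K y = d x y"
    using tight_pair_leaving[OF M K TC opt R(1)] by blast
  have ay: "K a - K y = d a y"
    using xy triangle[of a x y] K_le[of a y] a(1) by (auto simp: R_def)
  then have "y \<in> M - S"
    using xy(2) by (auto simp: R_def)
  then obtain p where p: "p \<in> {s, t}" "p \<in> M" "p \<noteq> a" "d a y = d a p + d p y"
    using gates by blast
  have "K a - K p = d a p"
    using ay p K_le[of a p] K_le[of p y] xy(2) a(1) by auto
  then have "(\<Sum>i\<in>UNIV. d a p - \<epsilon> $ i * (L i a - L i p)) = 0"
    using K_diff[of a p] by (simp add: sum_subtractf)
  then have tight: "\<epsilon> $ i * (L i a - L i p) = d a p" for i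
    using nonexpansive_mult_le[OF L(1) \<epsilon>(1) a(1) p(2)] by (subst (asm) sum_nonneg_eq_0_iff) auto
  have "d a p \<noteq> 0" using p(2,3) a(1) by simp
  have "\<epsilon> $ i = slope p $ i" for i
  proof -
    have "\<epsilon> $ i * d a p = (\<epsilon> $ i * \<epsilon> $ i) * (L i a - L i p)"
      by (simp add: tight[of i, symmetric])
    also have "\<epsilon> $ i * \<epsilon> $ i = 1"
      using \<epsilon>(1) by (metis abs_mult_self mult_1)
    finally show ?thesis
      using \<open>d a p \<noteq> 0\<close> by (simp add: slope_def field_simps)
  qed
  then have "\<epsilon> = slope p" by (simp add: vec_eq_iff)
  with p(1) \<epsilon>(3,4) show False by blast
qed

end


section \<open>Geodesics of diamond graphs\<close>

lemma (in pair_graph) graph_dist_walk_length: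
  assumes "c > 0" "awalk u p v"
  shows "graph_dist G (\<lambda>_. c) u v \<le> c * real (length p)"
    and "\<exists>q. awalk u q v \<and> graph_dist G (\<lambda>_. c) u v = c * real (length q)"
proof -
  have cost: "awalk_cost (\<lambda>_. c) q = c * real (length q)" for q :: "('a \<times> 'a) list"
    by (induction q) (auto simp: algebra_simps)
  have reach: "u \<rightarrow>\<^sup>*\<^bsub>G\<^esub> v" using assms(2) by (auto simp: reachable_awalk)
  have "\<exists>q. apath u q v \<and> \<mu> (\<lambda>_. c) u v = awalk_cost (\<lambda>_. c) q"
    using assms(1) by (intro no_neg_cyc_reach_imp_path[OF reach]) (auto simp: cost not_less)
  then obtain q where q: "apath u q v" "\<mu> (\<lambda>_. c) u v = awalk_cost (\<lambda>_. c) q"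
    by blast
  then show "\<exists>q. awalk u q v \<and> graph_dist G (\<lambda>_. c) u v = c * real (length q)"
    by (intro exI[of _ q]) (auto simp: graph_dist_def apath_def cost)
  show "graph_dist G (\<lambda>_. c) u v \<le> c * real (length p)"
    using q(2) min_cost_le_walk_cost[OF assms(2), of "\<lambda>_. c"] by (simp add: graph_dist_def cost)
qed

lemma (in pair_graph) awalk_leaving_set:
  assumes "awalk u p v" "u \<in> S" "v \<notin> S"
    and "\<And>x y. (x, y) \<in> parcs G \<Longrightarrow> x \<in> S \<Longrightarrow> y \<notin> S \<Longrightarrow> y \<in> P"
  shows "\<exists>w\<in>P. \<exists>q r. awalk u q w \<and> awalk w r v \<and> length p = length q + length r"
  using assms(1,2)
proof (induction p arbitrary: u)
  case Nil
  with assms(3) show ?case by (auto simp: awalk_Nil_iff)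
next
  case (Cons e p)
  then have e: "e \<in> parcs G" "fst e = u" and p: "awalk (snd e) p v"
    by (auto simp: awalk_Cons_iff)
  show ?case
  proof (cases "snd e \<in> S")
    case True
    then obtain w q r where w: "w \<in> P" "awalk (snd e) q w" "awalk w r v" "length p = length q + length r"
      using Cons.IH[OF p] by blast
    have "awalk u (e # q) w"
      using e w(2) by (simp add: awalk_Cons_iff)
    then show ?thesis
      using w(1,3,4) by (intro bexI[of _ w] exI[of _ "e # q"] exI[of _ r] conjI) simp_all
  next
    case False
    then have "snd e \<in> P"
      using assms(4)[of u "snd e"] e Cons.prems(2) by (metis prod.collapse)
    moreover have "awalk u [e] (snd e)"
      using e p by (auto simp: awalk_simps)
    ultimately show ?thesis
      using p by (intro bexI[of _ "snd e"] exI[of _ "[e]"] exI[of _ p] conjI) simp_all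
  qed
qed

lemma diamond_walk_exists:
  assumes "u \<in> pverts (diamond n)" "v \<in> pverts (diamond n)"
  shows "\<exists>p. pre_digraph.awalk (with_proj (diamond n)) u p v"
proof -
  interpret pair_graph "diamond n" by (rule pair_graph_diamond)
  have "\<exists>p. awalk u p v" if "(u, v) \<in> (parcs (diamond n))\<^sup>*" "u \<in> pverts (diamond n)" for u v
    using that
  proof (induction rule: converse_rtrancl_induct)
    case base
    then show ?case by (auto simp: awalk_Nil_iff intro!: exI[of _ "[]"])
  next
    case (step x y)
    then obtain p where "awalk y p v"
      using in_arcsD2 by blast
    with step.hyps(1) have "awalk x ((x, y) # p) v"
      by (simp add: awalk_Cons_iff)
    then show ?case ..
  qed
  note walk = this
  obtain p q where "awalk u p (Pole False)" "awalk v q (Pole False)"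
    using walk diamond_reach_Pole assms by meson
  then have "awalk u (p @ rev (map prod.swap q)) v"
    using awalk_rev by auto
  then show ?thesis ..
qed

text \<open>A shortest walk from \<open>a\<close> to \<open>y\<close> steps out of \<open>S\<close> somewhere, and is split at that point.\<close>

lemma diamond_dist_through_gate:
  assumes a: "a \<in> pverts (diamond n)" "a \<in> S" and y: "y \<in> pverts (diamond n)" "y \<notin> S"
    and P: "\<And>u v. (u, v) \<in> parcs (diamond n) \<Longrightarrow> u \<in> S \<Longrightarrow> v \<notin> S \<Longrightarrow> v \<in> P"
  shows "\<exists>p\<in>P. p \<in> pverts (diamond n) \<and>
           diamond_dist n a y = diamond_dist n a p + diamond_dist n p y"
proof -
  interpret pair_graph "diamond n" by (rule pair_graph_diamond)
  interpret Metric_space "pverts (diamond n)" "diamond_dist n" by (rule Metric_space_diamond)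
  have c: "(1 / 2 ^ n :: real) > 0" by simp
  obtain q where q: "awalk a q y" "diamond_dist n a y = (1 / 2 ^ n) * real (length q)"
    using diamond_walk_exists[OF a(1) y(1)] graph_dist_walk_length(2)[OF c]
    unfolding diamond_dist_def by meson
  obtain p q1 q2 where p: "p \<in> P" "awalk a q1 p" "awalk p q2 y" "length q = length q1 + length q2"
    using awalk_leaving_set[of a q y S P] q(1) a(2) y(2) P by blast
  have pM: "p \<in> pverts (diamond n)" using p(2) by auto
  have "diamond_dist n a p + diamond_dist n p y
      \<le> (1 / 2 ^ n) * real (length q1) + (1 / 2 ^ n) * real (length q2)"
    unfolding diamond_dist_def
    by (intro add_mono graph_dist_walk_length(1)[OF c] p)
  also have "\<dots> = diamond_dist n a y"
    using q(2) p(4) by (simp add: distrib_left)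
  finally show ?thesis
    using p(1) pM triangle[OF a(1) pM y(1)] by force
qed

text \<open>
  The name of a vertex records the edges inside which it was created.  Thus for \<open>a = Mid s t b\<close>
  the vertices in whose name \<open>a\<close> occurs are \<open>a\<close> itself and the later vertices inside the edges
  \<open>sa\<close> and \<open>at\<close>.
\<close>

primrec occurs_in :: "dvertex \<Rightarrow> dvertex \<Rightarrow> bool" where
  "occurs_in a (Pole c) \<longleftrightarrow> a = Pole c"
| "occurs_in a (Mid u v c) \<longleftrightarrow> a = Mid u v c \<or> occurs_in a u \<or> occurs_in a v"

lemma occurs_in_refl: "occurs_in a a"
  by (cases a) auto

lemma occurs_in_level: "occurs_in a v \<Longrightarrow> v \<noteq> a \<Longrightarrow> level a < level v"
  by (induction v) (auto simp: less_Suc_eq_le le_max_iff_disj, (metis less_imp_le order_refl)+)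

text \<open>
  When an arc \<open>xy\<close> is subdivided, its midpoint contains \<open>a\<close> as soon as one of \<open>x\<close>, \<open>y\<close> does.  So if an
  arc at the midpoint joins the two sides, the end without \<open>a\<close> is the one at which \<open>xy\<close> itself
  already joined them; the first such arcs are \<open>sa\<close> and \<open>at\<close>.
\<close>

lemma oriented_arc_leaving_occurrences:
  assumes "(u, v) \<in> parcs (oriented_diamond n)" "a = Mid s t b"
    and "occurs_in a u \<noteq> occurs_in a v"
  shows "(if occurs_in a u then v else u) \<in> {s, t}"
  using assms(1,3)
proof (induction n arbitrary: u v)
  case (Suc n)
  from Suc.prems(1) have "\<exists>x y c. (x, y) \<in> parcs (oriented_diamond n) \<and>
      ((u, v) = (x, Mid x y c) \<or> (u, v) = (Mid x y c, y))"
    by (auto simp: diamond_step_def)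
  then obtain x y c where xy: "(x, y) \<in> parcs (oriented_diamond n)"
    and uv: "(u, v) = (x, Mid x y c) \<or> (u, v) = (Mid x y c, y)"
    by blast
  show ?case
  proof (cases "Mid x y c = a")
    case True
    with uv Suc.prems(2) assms(2) show ?thesis by (auto simp: occurs_in_refl)
  next
    case False
    with uv Suc.prems(2) Suc.IH[OF xy] show ?thesis by (auto split: if_splits)
  qed
qed (use assms(2) in auto)

lemma diamond_arc_leaving_occurrences:
  assumes "(u, v) \<in> parcs (diamond n)" "occurs_in (Mid s t b) u" "\<not> occurs_in (Mid s t b) v"
  shows "v \<in> {s, t}"
  using assms oriented_arc_leaving_occurrences[OF _ refl, of u v n s t b]
    oriented_arc_leaving_occurrences[OF _ refl, of v u n s t b]
  by (auto simp: parcs_diamond)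


section \<open>The transportation cost space of a diamond graph\<close>

theorem corollary3p7:
  fixes n :: nat
  assumes "n \<ge> 1"
  shows "\<not> (\<exists>W. W \<subseteq> TC (pverts (diamond n)) \<and> fun_space.subspace W \<and>
               isometric_to_linf TYPE(4) W (TC_norm (pverts (diamond n)) (diamond_dist n)))"
proof
  let ?M = "pverts (diamond n)"
  assume "\<exists>W. W \<subseteq> TC ?M \<and> fun_space.subspace W \<and>
    isometric_to_linf TYPE(4) W (TC_norm ?M (diamond_dist n))"
  then obtain W where W: "W \<subseteq> TC ?M" "isometric_to_linf TYPE(4) W (TC_norm ?M (diamond_dist n))"
    by blast
  interpret Metric_space ?M "diamond_dist n" by (rule Metric_space_diamond)
  have M: "finite ?M" using oriented_diamond_finite[of n] by simp
  define U where "U = {v \<in> ?M. \<exists>f\<in>W. f v \<noteq> 0}"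
  have "\<exists>f\<in>W. f \<noteq> 0"
  proof -
    obtain T :: "real ^ 4 \<Rightarrow> dvertex \<Rightarrow> real" where T: "bij_betw T UNIV W"
      using W(2) unfolding isometric_to_linf_def by blast
    have "T 0 \<in> W" "T 1 \<in> W" "T 0 \<noteq> T 1"
      using T by (auto simp: bij_betw_def inj_eq)
    then show ?thesis by metis
  qed
  then obtain f where f: "f \<in> W" "f \<noteq> 0" ..
  then obtain v where "f v \<noteq> 0" by (auto simp: fun_eq_iff)
  with f W(1) have "v \<in> U" by (auto simp: U_def TC_def)
  then have U: "finite (level ` U)" "level ` U \<noteq> {}"
    using M by (auto simp: U_def)
  then obtain a where "a \<in> U" "level a = Max (level ` U)"
    using Max_in by (metis imageE)
  with U have a: "a \<in> U" "\<And>v. v \<in> U \<Longrightarrow> level v \<le> level a"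
    by auto
  then obtain g where g: "a \<in> ?M" "g \<in> W" "g a \<noteq> 0" by (auto simp: U_def)
  have zero: "h v = 0" if "h \<in> W" "level a < level v" for h v
  proof (rule ccontr)
    assume "h v \<noteq> 0"
    then have "v \<in> U" using that(1) W(1) by (auto simp: U_def TC_def)
    then show False using a(2) that(2) by fastforce
  qed
  note obstruct = two_gates_obstruct_linf[where 'k = 4, OF M _ W g(1) _ g(2,3)]
  show False
  proof (cases a)
    case (Mid s t b)
    show False
    proof (rule obstruct[where S = "{v. occurs_in a v}" and s = s and t = t])
      show "h v = 0" if "h \<in> W" "v \<in> {v. occurs_in a v} - {a}" for h v
        using that occurs_in_level by (intro zero) auto
      show "\<exists>p\<in>{s, t}. p \<in> ?M \<and> p \<noteq> a \<and> diamond_dist n a y = diamond_dist n a p + diamond_dist n p y"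
        if "y \<in> ?M - {v. occurs_in a v}" for y
      proof -
        have "s \<noteq> a" "t \<noteq> a" using Mid by auto
        moreover have "\<exists>p\<in>{s, t}. p \<in> ?M \<and>
            diamond_dist n a y = diamond_dist n a p + diamond_dist n p y"
          using that g(1) diamond_arc_leaving_occurrences[of _ _ n s t b]
          unfolding Mid
          by (intro diamond_dist_through_gate[where S = "{v. occurs_in (Mid s t b) v}"])
            (auto simp: occurs_in_refl)
        ultimately show ?thesis by blast
      qed
    qed (auto simp: occurs_in_refl)
  next
    case (Pole c)
    let ?p = "Pole (\<not> c)"
    show False
    proof (rule obstruct[where S = "- {?p}" and s = ?p and t = ?p])
      show "h v = 0" if "h \<in> W" "v \<in> - {?p} - {a}" for h v
      proof -
        have "level v > 0" using that(2) Pole by (cases v) auto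
        with Pole show ?thesis by (intro zero[OF that(1)]) simp
      qed
      show "\<exists>p\<in>{?p, ?p}. p \<in> ?M \<and> p \<noteq> a \<and> diamond_dist n a y = diamond_dist n a p + diamond_dist n p y"
        if "y \<in> ?M - - {?p}" for y
        using that Pole by auto
    qed (use Pole in auto)
  qed
qed

end
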